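(* Let $S$ be a nonempty commutative semigroup and $G$ a group. For any element $f\in G$ and any polynomial map $f':S\to G$ of lc-height $k'$ and degree $d'$, the $f$-conjugate $$ff'f^{-1}:S\to G;\quad t\mapsto ff'(t)f^{-1}$$ is a polynomial map of lc-height $k'$ and degree $d'$.
   Context: The lower central series is $C^1G=G$, $C^{i+1}G=[C^iG,G]$. A function $S\to G$ has lc-height $k$ (or $\ge k$) if its image lies in $C^kG$. Let $S$ be a nonempty commutative semigroup (written additively) and $G$ a group with identity $1_G$. A map $f:S\to G$ is a polynomial map of degree $-\infty$ if $f(s)=1_G$ for all $s$, and of degree $0$ if it is constant with value different from $1_G$. Thus degree $\le 0$ means constant. Inductively, for $d\in\{0,1,2,\dots\}$, $f$ is a polynomial map of degree $\le d+1$ if for every $s\in S$ both maps $L_s(f):t\mapsto f(s+t)f(t)^{-1}$ and $R_s(f):t\mapsto f(t)^{-1}f(s+t)$ from $S$ to $G$ are polynomial maps of degree $\le d$. The degree of a polynomial map is the least such $d\in\{-\infty,0,1,2,\dots\}$. A map is a polynomial map if it is a polynomial map of degree $\le d$ for some $d$. *)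

theory Defs
  imports "HOL-Algebra.Generated_Groups" "HOL-Library.Option_ord"
begin

definition commutator_subgroup :: "('g, 'm) monoid_scheme \<Rightarrow> 'g set \<Rightarrow> 'g set \<Rightarrow> 'g set" where
  "commutator_subgroup G H K =
     generate G {h \<otimes>\<^bsub>G\<^esub> k \<otimes>\<^bsub>G\<^esub> inv\<^bsub>G\<^esub> h \<otimes>\<^bsub>G\<^esub> inv\<^bsub>G\<^esub> k | h k. h \<in> H \<and> k \<in> K}"

text \<open>
  The lower central series is indexed from \<open>1\<close>, with \<open>C\<^sup>1 G = G\<close>; the value at index \<open>0\<close> is a
  dummy.
\<close>

fun lower_central :: "('g, 'm) monoid_scheme \<Rightarrow> nat \<Rightarrow> 'g set" where
  "lower_central G 0 = carrier G"
| "lower_central G (Suc 0) = carrier G"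
| "lower_central G (Suc (Suc i)) =
     commutator_subgroup G (lower_central G (Suc i)) (carrier G)"

definition has_lc_height :: "('g, 'm) monoid_scheme \<Rightarrow> nat \<Rightarrow> ('s \<Rightarrow> 'g) \<Rightarrow> bool" where
  "has_lc_height G k f \<longleftrightarrow> range f \<subseteq> lower_central G k"

definition left_diff ::
    "('g, 'm) monoid_scheme \<Rightarrow> 's::ab_semigroup_add \<Rightarrow> ('s \<Rightarrow> 'g) \<Rightarrow> 's \<Rightarrow> 'g" where
  "left_diff G s f = (\<lambda>t. f (s + t) \<otimes>\<^bsub>G\<^esub> inv\<^bsub>G\<^esub> (f t))"

definition right_diff ::
    "('g, 'm) monoid_scheme \<Rightarrow> 's::ab_semigroup_add \<Rightarrow> ('s \<Rightarrow> 'g) \<Rightarrow> 's \<Rightarrow> 'g" where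
  "right_diff G s f = (\<lambda>t. inv\<^bsub>G\<^esub> (f t) \<otimes>\<^bsub>G\<^esub> f (s + t))"

text \<open>
  Degrees live in \<open>{-\<infinity>, 0, 1, 2, \<dots>}\<close>, encoded as \<open>nat option\<close> with \<open>None\<close> for \<open>-\<infinity>\<close>, which is
  the least element in the order of \<^theory>\<open>HOL-Library.Option_ord\<close>. The semigroup is the whole
  type \<open>'s\<close>, hence nonempty.
\<close>

fun poly_map_deg_le ::
    "('g, 'm) monoid_scheme \<Rightarrow> nat option \<Rightarrow> ('s::ab_semigroup_add \<Rightarrow> 'g) \<Rightarrow> bool" where
  "poly_map_deg_le G None f \<longleftrightarrow> (\<forall>s. f s = \<one>\<^bsub>G\<^esub>)"
| "poly_map_deg_le G (Some 0) f \<longleftrightarrow> (\<exists>c \<in> carrier G. \<forall>s. f s = c)"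
| "poly_map_deg_le G (Some (Suc d)) f \<longleftrightarrow>
     f \<in> UNIV \<rightarrow> carrier G \<and>
     (\<forall>s. poly_map_deg_le G (Some d) (left_diff G s f) \<and>
          poly_map_deg_le G (Some d) (right_diff G s f))"

definition polynomial_map ::
    "('g, 'm) monoid_scheme \<Rightarrow> ('s::ab_semigroup_add \<Rightarrow> 'g) \<Rightarrow> bool" where
  "polynomial_map G f \<longleftrightarrow> (\<exists>d. poly_map_deg_le G d f)"

text \<open>Only meaningful for polynomial maps.\<close>

definition poly_map_degree ::
    "('g, 'm) monoid_scheme \<Rightarrow> ('s::ab_semigroup_add \<Rightarrow> 'g) \<Rightarrow> nat option" where
  "poly_map_degree G f = (LEAST d. poly_map_deg_le G d f)"

end

theory Submission imports Defs begin

text \<open>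
  Conjugation by a group element is an injective endomorphism, and both notions involved are
  invariant under such maps. A homomorphism commutes with the difference operators
  \<open>L\<^sub>s\<close> and \<open>R\<^sub>s\<close>, so the iterated differences of the conjugate are the conjugates of the
  iterated differences; an injective homomorphism moreover reflects constancy and triviality.
  Hence a map and its conjugate satisfy exactly the same degree bounds
  (\<open>poly_map_deg_le_inj_hom_iff\<close>), so they have the same degree and not merely a bound in one
  direction. The terms of the lower central series are generated by commutators, so every
  homomorphism respects them (\<open>lower_central_hom_image\<close>), which gives the height.
\<close>

lemma (in group) lower_central_in_carrier: "lower_central G i \<subseteq> carrier G"
proof (induction i rule: induct_nat_012)
  case (ge2 n)
  then show ?case
    unfolding lower_central.simps commutator_subgroup_def
    by (intro generate_incl) (auto dest!: subsetD)
qed simp_all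

text \<open>
  A homomorphism sends commutators of \<open>C\<^sup>i G\<close> with \<open>G\<close> to commutators of \<open>C\<^sup>i H\<close> with \<open>H\<close>, and
  the image of a generated subgroup is generated by the images.
\<close>

lemma (in group_hom) lower_central_hom_image:
  "h ` lower_central G i \<subseteq> lower_central H i"
proof (induction i rule: induct_nat_012)
  case (ge2 n)
  let ?CG = "lower_central G (Suc n)" and ?CH = "lower_central H (Suc n)"
  let ?X = "{a \<otimes>\<^bsub>G\<^esub> b \<otimes>\<^bsub>G\<^esub> inv\<^bsub>G\<^esub> a \<otimes>\<^bsub>G\<^esub> inv\<^bsub>G\<^esub> b | a b. a \<in> ?CG \<and> b \<in> carrier G}"
  let ?Y = "{a \<otimes>\<^bsub>H\<^esub> b \<otimes>\<^bsub>H\<^esub> inv\<^bsub>H\<^esub> a \<otimes>\<^bsub>H\<^esub> inv\<^bsub>H\<^esub> b | a b. a \<in> ?CH \<and> b \<in> carrier H}"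
  have carr: "a \<in> carrier G" if "a \<in> ?CG" for a
    using G.lower_central_in_carrier that by blast
  have "?X \<subseteq> carrier G"
    using carr by auto
  then have "h ` generate G ?X = generate H (h ` ?X)"
    by (rule generate_img[symmetric])
  also have "h ` ?X \<subseteq> ?Y"
  proof
    fix y assume "y \<in> h ` ?X"
    then obtain a b where ab: "a \<in> ?CG" "b \<in> carrier G"
      and y: "y = h (a \<otimes>\<^bsub>G\<^esub> b \<otimes>\<^bsub>G\<^esub> inv\<^bsub>G\<^esub> a \<otimes>\<^bsub>G\<^esub> inv\<^bsub>G\<^esub> b)"
      by blast
    have "y = h a \<otimes>\<^bsub>H\<^esub> h b \<otimes>\<^bsub>H\<^esub> inv\<^bsub>H\<^esub> (h a) \<otimes>\<^bsub>H\<^esub> inv\<^bsub>H\<^esub> (h b)"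
      using ab carr by (simp add: y)
    moreover have "h a \<in> ?CH" "h b \<in> carrier H"
      using ab ge2(2) by auto
    ultimately show "y \<in> ?Y" by blast
  qed
  then have "generate H (h ` ?X) \<subseteq> generate H ?Y"
    by (rule H.mono_generate)
  finally show ?case
    by (simp add: commutator_subgroup_def)
qed auto

lemma (in group_hom) left_diff_hom:
  assumes "f \<in> UNIV \<rightarrow> carrier G"
  shows "left_diff H s (\<lambda>t. h (f t)) = (\<lambda>t. h (left_diff G s f t))"
  using assms by (auto simp: left_diff_def Pi_iff)

lemma (in group_hom) right_diff_hom:
  assumes "f \<in> UNIV \<rightarrow> carrier G"
  shows "right_diff H s (\<lambda>t. h (f t)) = (\<lambda>t. h (right_diff G s f t))"
  using assms by (auto simp: right_diff_def Pi_iff)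

lemma (in group) poly_map_deg_le_in_carrier:
  "poly_map_deg_le G d f \<Longrightarrow> f \<in> UNIV \<rightarrow> carrier G"
  by (cases "(G, d, f)" rule: poly_map_deg_le.cases) auto

text \<open>
  Since \<open>h\<close> commutes with the difference operators, the inductive step is the same in both
  directions; injectivity enters at degrees \<open>-\<infinity>\<close> and \<open>0\<close>, where it passes triviality and
  constancy of \<open>h \<circ> f\<close> back to \<open>f\<close>.
\<close>

lemma (in group_hom) poly_map_deg_le_inj_hom_iff:
  fixes f :: "'s::ab_semigroup_add \<Rightarrow> 'a"
  assumes inj: "inj_on h (carrier G)" and f: "f \<in> UNIV \<rightarrow> carrier G"
  shows "poly_map_deg_le H d (\<lambda>t. h (f t)) \<longleftrightarrow> poly_map_deg_le G d f"
proof (cases d)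
  case None
  have "h (f s) = \<one>\<^bsub>H\<^esub> \<longleftrightarrow> f s = \<one>\<^bsub>G\<^esub>" for s
    using inj_onD[OF inj, of "f s" "\<one>\<^bsub>G\<^esub>"] f by auto
  then show ?thesis by (simp add: None)
next
  case (Some n)
  from f have "poly_map_deg_le H (Some n) (\<lambda>t. h (f t)) \<longleftrightarrow> poly_map_deg_le G (Some n) f"
  proof (induction n arbitrary: f)
    case 0
    have eq: "h (f s) = h (f t) \<longleftrightarrow> f s = f t" for s t
      using inj_onD[OF inj, of "f s" "f t"] 0 by auto
    \<comment> \<open>Constancy is restated without naming the constant: a constant value of \<open>h \<circ> f\<close>
      is attained, so it is \<open>h\<close> of a value of \<open>f\<close>.\<close>
    have "poly_map_deg_le H (Some 0) (\<lambda>t. h (f t)) \<longleftrightarrow> (\<forall>s t. h (f s) = h (f t))"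
      using 0 by (auto simp: Pi_iff) (metis hom_closed)
    also have "\<dots> \<longleftrightarrow> poly_map_deg_le G (Some 0) f"
      using 0 by (auto simp: eq Pi_iff)
    finally show ?case .
  next
    case (Suc n)
    have "left_diff G s f \<in> UNIV \<rightarrow> carrier G" "right_diff G s f \<in> UNIV \<rightarrow> carrier G" for s
      using Suc.prems by (auto simp: left_diff_def right_diff_def Pi_iff)
    then show ?case
      using Suc.prems by (simp add: left_diff_hom right_diff_hom Suc.IH Pi_iff)
  qed
  then show ?thesis by (simp add: Some)
qed

lemma (in group) conjugation_group_hom:
  assumes "c \<in> carrier G"
  shows "group_hom G G (\<lambda>x. c \<otimes> x \<otimes> inv c)"
proof unfold_locales
  show "(\<lambda>x. c \<otimes> x \<otimes> inv c) \<in> hom G G"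
  proof (rule homI)
    fix x y assume "x \<in> carrier G" "y \<in> carrier G"
    then show "c \<otimes> (x \<otimes> y) \<otimes> inv c = (c \<otimes> x \<otimes> inv c) \<otimes> (c \<otimes> y \<otimes> inv c)"
      using assms by (simp add: m_assoc inv_solve_left)
  qed (use assms in simp)
qed

lemma (in group) conjugation_inj_on:
  assumes "c \<in> carrier G"
  shows "inj_on (\<lambda>x. c \<otimes> x \<otimes> inv c) (carrier G)"
  using assms by (auto intro: inj_onI)

theorem corollary1:
  fixes G :: "('g, 'm) monoid_scheme" (structure)
    and f :: 'g
    and f' :: "'s::ab_semigroup_add \<Rightarrow> 'g"
    and k' :: nat and d' :: "nat option"
  assumes "group G"
    and "f \<in> carrier G"
    and "1 \<le> k'"
    and "polynomial_map G f'"
    and "has_lc_height G k' f'"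
    and "poly_map_degree G f' = d'"
  shows "polynomial_map G (\<lambda>t. f \<otimes> f' t \<otimes> inv f) \<and>
         has_lc_height G k' (\<lambda>t. f \<otimes> f' t \<otimes> inv f) \<and>
         poly_map_degree G (\<lambda>t. f \<otimes> f' t \<otimes> inv f) = d'"
proof -
  interpret group G by fact
  interpret conj: group_hom G G "\<lambda>x. f \<otimes> x \<otimes> inv f"
    using assms(2) by (rule conjugation_group_hom)
  have "f' \<in> UNIV \<rightarrow> carrier G"
    using assms(4) poly_map_deg_le_in_carrier by (auto simp: polynomial_map_def)
  then have same_bounds:
      "poly_map_deg_le G d (\<lambda>t. f \<otimes> f' t \<otimes> inv f) \<longleftrightarrow> poly_map_deg_le G d f'" for d
    using conj.poly_map_deg_le_inj_hom_iff[OF conjugation_inj_on[OF assms(2)]] by blast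
  have "has_lc_height G k' (\<lambda>t. f \<otimes> f' t \<otimes> inv f)"
    using assms(5) conj.lower_central_hom_image[of k'] by (auto simp: has_lc_height_def)
  then show ?thesis
    using assms(4,6) by (simp add: polynomial_map_def poly_map_degree_def same_bounds)
qed

end
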